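(* Let $F$ be a normed lattice. Then $F$ is order continuous if and only if every renorming of $F$ is semicontinuous.
   Context: A normed lattice is a real vector lattice with a lattice (solid) norm; norm completeness is not assumed. A renorming of $F$ is the vector lattice $F$ endowed with a solid norm equivalent to the given one. For a set $P$ in a vector lattice, $P\uparrow f$ means that $P$ is (nonempty and) upward directed with supremum $f$; $P\downarrow f$ means that $P$ is downward directed with infimum $f$. The closed unit ball of $F$ is $B_F$ and $B_{F_+}=B_F\cap F_+$. A normed lattice $F$ is order continuous if whenever $P\subset F$ satisfies $P\downarrow 0$, then $\inf_{p\in P}\|p\|=0$. $F$ is (order) semicontinuous if whenever $P\subset B_{F_+}$ and $f\in F$ satisfy $P\uparrow f$, then $\|f\|\le 1$. *)

theory Defs
  imports Complex_Main "HOL-Library.Lattice_Algebras" "HOL-Library.Lub_Glb"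
begin

class vector_lattice = ordered_real_vector + lattice_ab_group_add_abs

(* A normed lattice is a type of class vector_lattice together with a function satisfying
   lattice_norm. The norm is a parameter, and not that of class real_normed_vector, because
   renormings put other norms on the same vector lattice. *)
definition lattice_norm :: "('a::vector_lattice \<Rightarrow> real) \<Rightarrow> bool" where
  "lattice_norm N \<longleftrightarrow>
     (\<forall>x. N x = 0 \<longleftrightarrow> x = 0) \<and>
     (\<forall>x y. N (x + y) \<le> N x + N y) \<and>
     (\<forall>c x. N (c *\<^sub>R x) = \<bar>c\<bar> * N x) \<and>
     (\<forall>x y. \<bar>x\<bar> \<le> \<bar>y\<bar> \<longrightarrow> N x \<le> N y)"

definition equivalent_norms :: "('a \<Rightarrow> real) \<Rightarrow> ('a \<Rightarrow> real) \<Rightarrow> bool" where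
  "equivalent_norms N M \<longleftrightarrow>
     (\<exists>c>0. \<exists>C>0. \<forall>x. c * N x \<le> M x \<and> M x \<le> C * N x)"

definition renorming :: "('a::vector_lattice \<Rightarrow> real) \<Rightarrow> ('a \<Rightarrow> real) \<Rightarrow> bool" where
  "renorming N M \<longleftrightarrow> lattice_norm M \<and> equivalent_norms N M"

definition increases_to :: "'a::order set \<Rightarrow> 'a \<Rightarrow> bool" where
  "increases_to P f \<longleftrightarrow>
     P \<noteq> {} \<and> (\<forall>a\<in>P. \<forall>b\<in>P. \<exists>c\<in>P. a \<le> c \<and> b \<le> c) \<and> isLub UNIV P f"

definition decreases_to :: "'a::order set \<Rightarrow> 'a \<Rightarrow> bool" where
  "decreases_to P f \<longleftrightarrow>
     P \<noteq> {} \<and> (\<forall>a\<in>P. \<forall>b\<in>P. \<exists>c\<in>P. c \<le> a \<and> c \<le> b) \<and> isGlb UNIV P f"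

definition order_continuous_norm :: "('a::vector_lattice \<Rightarrow> real) \<Rightarrow> bool" where
  "order_continuous_norm N \<longleftrightarrow> (\<forall>P. decreases_to P 0 \<longrightarrow> (INF p\<in>P. N p) = 0)"

definition semicontinuous_norm :: "('a::vector_lattice \<Rightarrow> real) \<Rightarrow> bool" where
  "semicontinuous_norm N \<longleftrightarrow>
     (\<forall>P f. P \<subseteq> {x. N x \<le> 1 \<and> 0 \<le> x} \<and> increases_to P f \<longrightarrow> N f \<le> 1)"

end

theory Submission
  imports Defs
begin

text \<open>
  If \<open>N\<close> is order continuous, so is every equivalent norm \<open>M\<close>, and \<open>P \<up> f\<close> gives
  \<open>M f \<le> M p + M (f - p)\<close> with \<open>M (f - p)\<close> arbitrarily small.

  Conversely, let \<open>P \<down> 0\<close> with \<open>N p \<ge> \<delta> > 0\<close> on \<open>P\<close>, where we may assume \<open>P \<le> p\<^sub>0\<close> for some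
  \<open>p\<^sub>0 \<in> P\<close>. The set \<open>D = p\<^sub>0 - P\<close> increases to \<open>p\<^sub>0\<close>. Since \<open>D\<close> is directed, the solid hull of \<open>D\<close>
  is convex, and the gauge of the convex hull of it together with a small \<open>N\<close>-ball is a renorming \<open>M\<close>
  with \<open>M \<le> 1\<close> on \<open>D\<close>. If \<open>p\<^sub>0 \<le> s (p\<^sub>0 - p) + y\<close> with \<open>s\<close> close to \<open>1\<close>, then \<open>y\<close>
  nearly dominates \<open>p\<close>, so \<open>N y\<close> is not small; this forces \<open>M p\<^sub>0 > 1\<close>.
\<close>

section \<open>Directed suprema and infima in vector lattices\<close>

lemma isLub_UNIV_iff:
  "isLub UNIV P (f::'a::order) \<longleftrightarrow> (\<forall>p\<in>P. p \<le> f) \<and> (\<forall>u. (\<forall>p\<in>P. p \<le> u) \<longrightarrow> f \<le> u)"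
  by (auto simp: isLub_def leastP_def isUb_def setle_def setge_def)

lemma isGlb_UNIV_iff:
  "isGlb UNIV P (f::'a::order) \<longleftrightarrow> (\<forall>p\<in>P. f \<le> p) \<and> (\<forall>u. (\<forall>p\<in>P. u \<le> p) \<longrightarrow> u \<le> f)"
  by (auto simp: isGlb_def greatestP_def isLb_def setle_def setge_def)

lemma decreases_to_diff:
  fixes f :: "'a::vector_lattice"
  assumes "increases_to P f"
  shows "decreases_to ((\<lambda>p. f - p) ` P) 0"
proof -
  have "u \<le> 0" if u: "\<forall>p\<in>P. u \<le> f - p" for u
  proof -
    have "\<forall>p\<in>P. p \<le> f - u"
      using u by (simp add: algebra_simps)
    then have "f \<le> f - u"
      using assms unfolding increases_to_def isLub_UNIV_iff by blast
    then show ?thesis by simp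
  qed
  then show ?thesis
    using assms unfolding increases_to_def decreases_to_def isLub_UNIV_iff isGlb_UNIV_iff
    by simp
qed

lemma increases_to_diff:
  fixes f :: "'a::vector_lattice"
  assumes "decreases_to P 0"
  shows "increases_to ((\<lambda>p. f - p) ` P) f"
proof -
  have "f \<le> u" if u: "\<forall>p\<in>P. f - p \<le> u" for u
  proof -
    have "\<forall>p\<in>P. f - u \<le> p"
      using u by (simp add: algebra_simps)
    then have "f - u \<le> 0"
      using assms unfolding decreases_to_def isGlb_UNIV_iff by blast
    then show ?thesis by simp
  qed
  then show ?thesis
    using assms unfolding increases_to_def decreases_to_def isLub_UNIV_iff isGlb_UNIV_iff
    by simp
qed

text \<open>By directedness, every member of \<open>P\<close> has below it a member that is also
  below \<open>q\<close>, so passing to this tail creates no new lower bounds. It makes the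
  differences \<open>q - p\<close> positive later on.\<close>

lemma decreases_to_below:
  fixes q :: "'a::order"
  assumes P: "decreases_to P f" and q: "q \<in> P"
  shows "decreases_to {p \<in> P. p \<le> q} f"
  unfolding decreases_to_def isGlb_UNIV_iff
proof (intro conjI ballI allI impI)
  have dir: "\<exists>c\<in>P. c \<le> a \<and> c \<le> b" if "a \<in> P" "b \<in> P" for a b
    using P that unfolding decreases_to_def by blast
  show "{p \<in> P. p \<le> q} \<noteq> {}"
    using q by auto
  show "\<exists>c\<in>{p \<in> P. p \<le> q}. c \<le> a \<and> c \<le> b" if "a \<in> {p \<in> P. p \<le> q}" "b \<in> {p \<in> P. p \<le> q}" for a b
    using that dir[of a b] by (auto intro: order_trans)
  show "f \<le> p" if "p \<in> {p \<in> P. p \<le> q}" for p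
    using P that unfolding decreases_to_def isGlb_UNIV_iff by simp
  show "u \<le> f" if u: "\<forall>p\<in>{p \<in> P. p \<le> q}. u \<le> p" for u
  proof -
    have "u \<le> p" if "p \<in> P" for p
      using dir[OF that q] u by (auto intro: order_trans)
    then show ?thesis
      using P unfolding decreases_to_def isGlb_UNIV_iff by simp
  qed
qed

text \<open>Both \<open>x\<close> and \<open>- x\<close> lie below \<open>\<bar>x\<bar>\<close>;
  scaling these two inequalities by the nonnegative one of \<open>c\<close> and \<open>- c\<close>
  bounds \<open>c *\<^sub>R x\<close> and its negative.\<close>

lemma abs_scaleR_le:
  fixes x :: "'a::vector_lattice"
  shows "\<bar>c *\<^sub>R x\<bar> \<le> \<bar>c\<bar> *\<^sub>R \<bar>x\<bar>"
proof (cases "c \<ge> 0")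
  case True
  then show ?thesis
    using scaleR_left_mono[OF abs_ge_self[of x], of c]
      scaleR_left_mono[OF abs_ge_minus_self[of x], of c]
    by (intro abs_leI) auto
next
  case False
  then show ?thesis
    using scaleR_left_mono[OF abs_ge_self[of x], of "- c"]
      scaleR_left_mono[OF abs_ge_minus_self[of x], of "- c"]
    by (intro abs_leI) auto
qed

section \<open>Lattice norms and order continuity\<close>

context
  fixes N :: "'a::vector_lattice \<Rightarrow> real"
  assumes N: "lattice_norm N"
begin

lemma lattice_norm_zero_iff: "N x = 0 \<longleftrightarrow> x = 0"
  and lattice_norm_triangle: "N (x + y) \<le> N x + N y"
  and lattice_norm_scaleR: "N (c *\<^sub>R x) = \<bar>c\<bar> * N x"
  and lattice_norm_solid: "\<bar>x\<bar> \<le> \<bar>y\<bar> \<Longrightarrow> N x \<le> N y"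
  using N unfolding lattice_norm_def by auto

lemma lattice_norm_mono: "0 \<le> x \<Longrightarrow> x \<le> y \<Longrightarrow> N x \<le> N y"
  using lattice_norm_solid[of x y] by (simp add: order_trans)

lemma lattice_norm_abs: "N \<bar>x\<bar> = N x"
  by (intro antisym lattice_norm_solid) auto

lemma lattice_norm_nonneg: "0 \<le> N x"
  using lattice_norm_mono[of 0 "\<bar>x\<bar>"] lattice_norm_zero_iff[of 0] by (simp add: lattice_norm_abs)

lemma order_continuous_normD:
  assumes "order_continuous_norm N" "decreases_to P 0" "e > 0"
  shows "\<exists>p\<in>P. N p < e"
proof -
  have "(INF p\<in>P. N p) = 0" "P \<noteq> {}"
    using assms unfolding order_continuous_norm_def decreases_to_def by auto
  then show ?thesis
    using cInf_lessD[of "N ` P" e] assms(3) by auto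
qed

text \<open>Norm values are nonnegative, so an infimum other than \<open>0\<close> is positive and
  itself serves as \<open>\<delta>\<close>.\<close>

lemma not_order_continuous_normE:
  assumes "\<not> order_continuous_norm N"
  obtains P \<delta> where "decreases_to P 0" "\<delta> > 0" "\<And>p. p \<in> P \<Longrightarrow> \<delta> \<le> N p"
proof -
  obtain P where P: "decreases_to P 0" "(INF p\<in>P. N p) \<noteq> 0"
    using assms unfolding order_continuous_norm_def by blast
  have "P \<noteq> {}"
    using P unfolding decreases_to_def by blast
  then have "0 \<le> (INF p\<in>P. N p)"
    by (intro cINF_greatest lattice_norm_nonneg)
  moreover have "(INF p\<in>P. N p) \<le> N p" if "p \<in> P" for p
    using that by (intro cINF_lower bdd_belowI2[where m=0] lattice_norm_nonneg)
  ultimately show thesis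
    using that P by (metis order_le_imp_less_or_eq)
qed

lemma semicontinuous_norm_renorming:
  assumes oc: "order_continuous_norm N" and M: "renorming N M"
  shows "semicontinuous_norm M"
  unfolding semicontinuous_norm_def
proof (intro allI impI, elim conjE)
  fix P f
  assume P: "P \<subseteq> {x. M x \<le> 1 \<and> 0 \<le> x}" "increases_to P f"
  obtain C where C: "C > 0" "\<And>x. M x \<le> C * N x"
    using M unfolding renorming_def equivalent_norms_def by blast
  show "M f \<le> 1"
  proof (rule field_le_epsilon)
    fix e :: real assume "e > 0"
    then obtain p where p: "p \<in> P" "N (f - p) < e / C"
      using order_continuous_normD[OF oc decreases_to_diff[OF P(2)], of "e / C"] C(1) by auto
    have "M f \<le> M p + M (f - p)"
      using M unfolding renorming_def lattice_norm_def
      by (metis add.commute diff_add_cancel)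
    moreover have "M (f - p) \<le> e"
      using C(2)[of "f - p"] p(2) C(1) by (simp add: field_simps)
    ultimately show "M f \<le> 1 + e"
      using P(1) p(1) by force
  qed
qed

end

section \<open>The gauge as a renorming\<close>

text \<open>For directed \<open>D \<ge> 0\<close>, this is the gauge of the convex hull of the solid hull of \<open>D\<close> and the
  \<open>N\<close>-ball of radius \<open>1 / k\<close>.\<close>

definition gauge_costs :: "('a::vector_lattice \<Rightarrow> real) \<Rightarrow> real \<Rightarrow> 'a set \<Rightarrow> 'a \<Rightarrow> real set" where
  "gauge_costs N k D x = {s + k * N y | s d y. 0 \<le> s \<and> d \<in> D \<and> \<bar>x\<bar> \<le> s *\<^sub>R d + y}"

definition hull_gauge :: "('a::vector_lattice \<Rightarrow> real) \<Rightarrow> real \<Rightarrow> 'a set \<Rightarrow> 'a \<Rightarrow> real" where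
  "hull_gauge N k D x = Inf (gauge_costs N k D x)"

context
  fixes N :: "'a::vector_lattice \<Rightarrow> real" and D :: "'a set" and k K :: real
  assumes N: "lattice_norm N" and k: "k > 0" and D_ne: "D \<noteq> {}"
    and D_nonneg: "\<And>d. d \<in> D \<Longrightarrow> 0 \<le> d" and D_bdd: "\<And>d. d \<in> D \<Longrightarrow> N d \<le> K"
    and D_dir: "\<And>a b. a \<in> D \<Longrightarrow> b \<in> D \<Longrightarrow> \<exists>c\<in>D. a \<le> c \<and> b \<le> c"
begin

lemma gauge_costs_memI:
  "0 \<le> s \<Longrightarrow> d \<in> D \<Longrightarrow> \<bar>x\<bar> \<le> s *\<^sub>R d + y \<Longrightarrow> s + k * N y \<in> gauge_costs N k D x"
  unfolding gauge_costs_def by blast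

lemma gauge_costs_nonneg: "t \<in> gauge_costs N k D x \<Longrightarrow> 0 \<le> t"
  unfolding gauge_costs_def using k lattice_norm_nonneg[OF N] by auto

lemma hull_gauge_lower: "t \<in> gauge_costs N k D x \<Longrightarrow> hull_gauge N k D x \<le> t"
  unfolding hull_gauge_def by (intro cInf_lower bdd_belowI[where m=0] gauge_costs_nonneg)

lemma gauge_costs_norm: "k * N x \<in> gauge_costs N k D x"
  using gauge_costs_memI[of 0 _ x "\<bar>x\<bar>"] D_ne by (auto simp: lattice_norm_abs[OF N])

lemma hull_gauge_greatest:
  "(\<And>t. t \<in> gauge_costs N k D x \<Longrightarrow> b \<le> t) \<Longrightarrow> b \<le> hull_gauge N k D x"
  unfolding hull_gauge_def using gauge_costs_norm by (intro cInf_greatest) auto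

lemma hull_gauge_le_norm: "hull_gauge N k D x \<le> k * N x"
  by (intro hull_gauge_lower gauge_costs_norm)

lemma hull_gauge_le_one: "d \<in> D \<Longrightarrow> hull_gauge N k D d \<le> 1"
  using hull_gauge_lower[OF gauge_costs_memI[of 1 d d 0]] D_nonneg lattice_norm_zero_iff[OF N, of 0]
  by simp

text \<open>Both generating sets, the solid hull of \<open>D\<close> and the ball of radius
  \<open>1 / k\<close>, are bounded in \<open>N\<close>. The sum of \<open>\<bar>K\<bar>\<close> and
  \<open>1 / k\<close> serves as a common bound.\<close>

lemma norm_le_hull_gauge: "N x \<le> (\<bar>K\<bar> + 1 / k) * hull_gauge N k D x"
proof -
  have pos: "\<bar>K\<bar> + 1 / k > 0"
    using k by (simp add: add_nonneg_pos)
  have "N x / (\<bar>K\<bar> + 1 / k) \<le> hull_gauge N k D x"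
  proof (rule hull_gauge_greatest)
    fix t assume "t \<in> gauge_costs N k D x"
    then obtain s d y where t: "t = s + k * N y" "0 \<le> s" "d \<in> D" "\<bar>x\<bar> \<le> s *\<^sub>R d + y"
      unfolding gauge_costs_def by blast
    have "N x \<le> N (s *\<^sub>R d + y)"
      using lattice_norm_mono[OF N _ t(4)] by (simp add: lattice_norm_abs[OF N])
    also have "\<dots> \<le> s * N d + N y"
      using lattice_norm_triangle[OF N, of "s *\<^sub>R d" y] t(2) by (simp add: lattice_norm_scaleR[OF N])
    also have "s * N d \<le> s * \<bar>K\<bar>"
      using D_bdd[OF t(3)] t(2) by (intro mult_left_mono) auto
    \<comment> \<open>Expanding the right side leaves only the nonnegative cross terms
      \<open>s / k\<close> and \<open>\<bar>K\<bar> * k * N y\<close> in excess.\<close>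
    also have "s * \<bar>K\<bar> + N y \<le> (\<bar>K\<bar> + 1 / k) * t"
      using k t(2) lattice_norm_nonneg[OF N, of y] by (simp add: t(1) field_simps)
    finally show "N x / (\<bar>K\<bar> + 1 / k) \<le> t"
      using pos by (simp add: pos_divide_le_eq mult.commute)
  qed
  then show ?thesis
    using pos by (simp add: pos_divide_le_eq mult.commute)
qed

text \<open>This is where directedness of \<open>D\<close> enters: a common upper bound
  \<open>c\<close> of \<open>d\<close> and \<open>e\<close> merges two decompositions into one with
  coefficient \<open>s + r\<close>.\<close>

lemma hull_gauge_triangle: "hull_gauge N k D (x + z) \<le> hull_gauge N k D x + hull_gauge N k D z"
proof -
  have *: "hull_gauge N k D (x + z) \<le> t + u"
    if "t \<in> gauge_costs N k D x" "u \<in> gauge_costs N k D z" for t u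
  proof -
    obtain s d y where t: "t = s + k * N y" "0 \<le> s" "d \<in> D" "\<bar>x\<bar> \<le> s *\<^sub>R d + y"
      using \<open>t \<in> _\<close> unfolding gauge_costs_def by blast
    obtain r e w where u: "u = r + k * N w" "0 \<le> r" "e \<in> D" "\<bar>z\<bar> \<le> r *\<^sub>R e + w"
      using \<open>u \<in> _\<close> unfolding gauge_costs_def by blast
    obtain c where c: "c \<in> D" "d \<le> c" "e \<le> c"
      using D_dir t(3) u(3) by blast
    have "\<bar>x + z\<bar> \<le> (s *\<^sub>R d + y) + (r *\<^sub>R e + w)"
      using abs_triangle_ineq[of x z] add_mono[OF t(4) u(4)] by (rule order_trans)
    also have "\<dots> \<le> (s *\<^sub>R c + y) + (r *\<^sub>R c + w)"
      using c t(2) u(2) by (intro add_mono scaleR_left_mono) auto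
    finally have "(s + r) + k * N (y + w) \<in> gauge_costs N k D (x + z)"
      using c(1) t(2) u(2) by (intro gauge_costs_memI[of _ c]) (auto simp: algebra_simps)
    then have "hull_gauge N k D (x + z) \<le> (s + r) + k * N (y + w)"
      by (rule hull_gauge_lower)
    also have "\<dots> \<le> t + u"
      using mult_left_mono[OF lattice_norm_triangle[OF N, of y w], of k] k
      by (simp add: t(1) u(1) algebra_simps)
    finally show ?thesis .
  qed
  \<comment> \<open>The infimum is taken over \<open>t\<close> first, with \<open>u\<close> fixed,
    and then over \<open>u\<close>.\<close>
  have "hull_gauge N k D (x + z) - u \<le> hull_gauge N k D x" if "u \<in> gauge_costs N k D z" for u
    using *[OF _ that] by (intro hull_gauge_greatest) (simp add: algebra_simps)
  then have "hull_gauge N k D (x + z) - hull_gauge N k D x \<le> hull_gauge N k D z"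
    by (intro hull_gauge_greatest) (simp add: algebra_simps)
  then show ?thesis by simp
qed

lemma hull_gauge_solid:
  assumes "\<bar>x\<bar> \<le> \<bar>z\<bar>"
  shows "hull_gauge N k D x \<le> hull_gauge N k D z"
proof (rule hull_gauge_greatest)
  fix t assume "t \<in> gauge_costs N k D z"
  then have "t \<in> gauge_costs N k D x"
    unfolding gauge_costs_def using assms order_trans by blast
  then show "hull_gauge N k D x \<le> t"
    by (rule hull_gauge_lower)
qed

lemma hull_gauge_scaleR_le:
  assumes "c \<noteq> 0"
  shows "hull_gauge N k D (c *\<^sub>R x) \<le> \<bar>c\<bar> * hull_gauge N k D x"
proof -
  have "hull_gauge N k D (c *\<^sub>R x) / \<bar>c\<bar> \<le> hull_gauge N k D x"
  proof (rule hull_gauge_greatest)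
    fix t assume "t \<in> gauge_costs N k D x"
    then obtain s d y where t: "t = s + k * N y" "0 \<le> s" "d \<in> D" "\<bar>x\<bar> \<le> s *\<^sub>R d + y"
      unfolding gauge_costs_def by blast
    have "\<bar>c *\<^sub>R x\<bar> \<le> \<bar>c\<bar> *\<^sub>R (s *\<^sub>R d + y)"
      using abs_scaleR_le[of c x] scaleR_left_mono[OF t(4), of "\<bar>c\<bar>"] by (auto intro: order_trans)
    then have "\<bar>c\<bar> * s + k * N (\<bar>c\<bar> *\<^sub>R y) \<in> gauge_costs N k D (c *\<^sub>R x)"
      using t(2,3) by (intro gauge_costs_memI[of _ d]) (auto simp: scaleR_add_right)
    then have "hull_gauge N k D (c *\<^sub>R x) \<le> \<bar>c\<bar> * t"
      using hull_gauge_lower by (fastforce simp: lattice_norm_scaleR[OF N] t(1) algebra_simps)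
    then show "hull_gauge N k D (c *\<^sub>R x) / \<bar>c\<bar> \<le> t"
      using assms by (simp add: pos_divide_le_eq mult.commute)
  qed
  then show ?thesis
    using assms by (simp add: pos_divide_le_eq mult.commute)
qed

lemma hull_gauge_zero_iff: "hull_gauge N k D x = 0 \<longleftrightarrow> x = 0"
proof
  assume "hull_gauge N k D x = 0"
  then have "N x = 0"
    using norm_le_hull_gauge[of x] lattice_norm_nonneg[OF N, of x] by simp
  then show "x = 0"
    by (simp add: lattice_norm_zero_iff[OF N])
next
  assume "x = 0"
  then have "hull_gauge N k D x \<le> 0"
    using hull_gauge_le_norm[of x] lattice_norm_zero_iff[OF N, of x] by simp
  moreover have "0 \<le> hull_gauge N k D x"
    by (intro hull_gauge_greatest gauge_costs_nonneg)
  ultimately show "hull_gauge N k D x = 0" by simp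
qed

text \<open>For \<open>c \<noteq> 0\<close>, the reverse inequality is the one already known,
  applied to \<open>inverse c\<close> and \<open>c *\<^sub>R x\<close>.\<close>

lemma hull_gauge_scaleR: "hull_gauge N k D (c *\<^sub>R x) = \<bar>c\<bar> * hull_gauge N k D x"
proof (cases "c = 0")
  case True
  then show ?thesis
    using hull_gauge_zero_iff[of 0] by simp
next
  case False
  have "hull_gauge N k D x \<le> \<bar>inverse c\<bar> * hull_gauge N k D (c *\<^sub>R x)"
    using hull_gauge_scaleR_le[of "inverse c" "c *\<^sub>R x"] False by simp
  then have "\<bar>c\<bar> * hull_gauge N k D x \<le> hull_gauge N k D (c *\<^sub>R x)"
    using False by (simp add: field_simps)
  then show ?thesis
    using hull_gauge_scaleR_le[OF False, of x] by simp
qed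

lemma renorming_hull_gauge: "renorming N (hull_gauge N k D)"
proof -
  have pos: "\<bar>K\<bar> + 1 / k > 0"
    using k by (simp add: add_nonneg_pos)
  have "1 / (\<bar>K\<bar> + 1 / k) * N x \<le> hull_gauge N k D x" for x
    using norm_le_hull_gauge[of x] pos by (simp add: pos_divide_le_eq mult.commute)
  then have "equivalent_norms N (hull_gauge N k D)"
    unfolding equivalent_norms_def using pos k hull_gauge_le_norm
    by (intro exI[of _ "1 / (\<bar>K\<bar> + 1 / k)"] conjI exI[of _ k]) auto
  then show ?thesis
    unfolding renorming_def lattice_norm_def
    using hull_gauge_zero_iff hull_gauge_triangle hull_gauge_scaleR hull_gauge_solid by blast
qed

end

section \<open>A renorming that is not semicontinuous\<close>

lemma ex_not_semicontinuous_renorming: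
  fixes N :: "'a::vector_lattice \<Rightarrow> real"
  assumes N: "lattice_norm N" and noc: "\<not> order_continuous_norm N"
  shows "\<exists>M. renorming N M \<and> \<not> semicontinuous_norm M"
proof -
  obtain P \<delta> where P: "decreases_to P 0" and \<delta>: "\<delta> > 0" "\<And>p. p \<in> P \<Longrightarrow> \<delta> \<le> N p"
    using not_order_continuous_normE[OF N noc] by metis
  obtain q where q: "q \<in> P"
    using P unfolding decreases_to_def by blast
  define D where "D = (\<lambda>p. q - p) ` {p \<in> P. p \<le> q}"
  have inc: "increases_to D q"
    unfolding D_def by (intro increases_to_diff decreases_to_below P q)
  have P_nonneg: "0 \<le> p" if "p \<in> P" for p
    using P that unfolding decreases_to_def isGlb_UNIV_iff by blast
  have D_nonneg: "0 \<le> d" if "d \<in> D" for d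
    using that unfolding D_def by auto
  have D_le: "N d \<le> N q" if "d \<in> D" for d
    using inc that D_nonneg[OF that] unfolding increases_to_def isLub_UNIV_iff
    by (intro lattice_norm_mono[OF N]) auto
  have D: "D \<noteq> {}" "\<And>a b. a \<in> D \<Longrightarrow> b \<in> D \<Longrightarrow> \<exists>c\<in>D. a \<le> c \<and> b \<le> c"
    using inc unfolding increases_to_def by blast+
  \<comment> \<open>With this \<open>k\<close>, any \<open>y\<close> with
    \<open>N y \<ge> \<delta> / 2\<close> costs at least \<open>2\<close>, hence at least
    \<open>1 + \<eta>\<close>.\<close>
  define k where "k = 4 / \<delta>"
  have k: "k > 0"
    using \<delta>(1) by (simp add: k_def)
  \<comment> \<open>Chosen so that \<open>\<eta>\<close> times a member of \<open>D\<close> has norm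
    at most \<open>\<delta> / 2\<close>, leaving the other half of \<open>\<delta>\<close> to
    \<open>y\<close>.\<close>
  define \<eta> where "\<eta> = \<delta> / (2 * N q)"
  have Nq: "\<delta> \<le> N q"
    using \<delta>(2) q by blast
  have \<eta>: "0 < \<eta>" "\<eta> \<le> 1" "\<eta> * N q = \<delta> / 2"
    using Nq \<delta>(1) by (auto simp: \<eta>_def field_simps)
  \<comment> \<open>The gauge is an infimum, so exceeding \<open>1\<close> takes a margin
    \<open>\<eta>\<close> that is uniform over all decompositions of \<open>q\<close>.\<close>
  have "1 + \<eta> \<le> hull_gauge N k D q"
  proof (rule hull_gauge_greatest[OF N k D(1) D_nonneg D_le D(2)])
    fix t assume "t \<in> gauge_costs N k D q"
    then obtain s d y where t: "t = s + k * N y" "0 \<le> s" "d \<in> D" "\<bar>q\<bar> \<le> s *\<^sub>R d + y"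
      unfolding gauge_costs_def by blast
    then obtain p where p: "p \<in> P" "d = q - p" "p \<le> q"
      unfolding D_def by blast
    have q_le: "q \<le> s *\<^sub>R (q - p) + y"
      using t(4) p(2) abs_ge_self[of q] by (auto intro: order_trans)
    show "1 + \<eta> \<le> t"
    \<comment> \<open>A larger \<open>s\<close> is already too expensive by itself; a smaller one
      forces \<open>y\<close> to carry most of \<open>p\<close>.\<close>
    proof (cases "s \<le> 1 + \<eta>")
      case True
      \<comment> \<open>Subtract \<open>q - p\<close> from both sides of \<open>q_le\<close>. The
        factor \<open>s - 1\<close> may be negative, but \<open>q - p \<ge> 0\<close> still allows
        replacing it by \<open>\<eta>\<close>.\<close>
      have "p \<le> (s - 1) *\<^sub>R (q - p) + y"
        using q_le by (simp add: algebra_simps)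
      also have "\<dots> \<le> \<eta> *\<^sub>R (q - p) + y"
        using True p(3) by (intro add_right_mono scaleR_right_mono) auto
      finally have "N p \<le> N (\<eta> *\<^sub>R (q - p) + y)"
        using P_nonneg[OF p(1)] by (intro lattice_norm_mono[OF N])
      also have "\<dots> \<le> \<eta> * N (q - p) + N y"
        using lattice_norm_triangle[OF N, of "\<eta> *\<^sub>R (q - p)" y] \<eta>(1)
        by (simp add: lattice_norm_scaleR[OF N])
      also have "\<eta> * N (q - p) \<le> \<delta> / 2"
        using mult_left_mono[OF D_le[OF t(3)], of \<eta>] \<eta> p(2) by simp
      finally have "\<delta> / 2 \<le> N y"
        using \<delta>(2)[OF p(1)] by simp
      then have "2 \<le> k * N y"
        using \<delta>(1) by (simp add: k_def field_simps)
      then show ?thesis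
        using t(1,2) \<eta>(2) by simp
    next
      case False
      then show ?thesis
        using t(1) mult_nonneg_nonneg[OF less_imp_le[OF k] lattice_norm_nonneg[OF N, of y]] by linarith
    qed
  qed
  then have "\<not> hull_gauge N k D q \<le> 1"
    using \<eta>(1) by simp
  moreover have "D \<subseteq> {x. hull_gauge N k D x \<le> 1 \<and> 0 \<le> x}"
    using hull_gauge_le_one[OF N k D(1) D_nonneg D_le D(2)] D_nonneg by blast
  ultimately have "\<not> semicontinuous_norm (hull_gauge N k D)"
    unfolding semicontinuous_norm_def using inc by blast
  then show ?thesis
    using renorming_hull_gauge[OF N k D(1) D_nonneg D_le D(2)] by blast
qed

theorem theorem3p3:
  fixes N :: "'a::vector_lattice \<Rightarrow> real"
  assumes "lattice_norm N"
  shows "order_continuous_norm N \<longleftrightarrow> (\<forall>M. renorming N M \<longrightarrow> semicontinuous_norm M)"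
  using semicontinuous_norm_renorming[OF assms] ex_not_semicontinuous_renorming[OF assms] by blast

end
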